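(* Let $A\in\mathbb{R}^{m\times n}$ have full row rank, $B\in\mathbb{R}^{p\times n}$, $b\in\mathbb{R}^m$, let $f(x)=\tfrac12x^THx+\zeta^Tx$ with $H\in\mathbb{S}_{++}^n$ and $\zeta\in\mathbb{R}^n$, and let $h=I_{Ax=b}$. Put $C=[A^T~B^T]^T\in\mathbb{R}^{(m+p)\times n}$, $c=(b,0)\in\mathbb{R}^{m+p}$, $F=f+h$, $d(\nu)=-F^\star(-C^T\nu)-c^T\nu$ for $\nu\in\mathbb{R}^{m+p}$, and $$M=H^{-1/2}A^T(AH^{-1}A^T)^{-1}AH^{-1/2}.$$ Then for all $\mathbf{L}\in\mathbb{S}_+^{m+p}$ such that $\mathbf{L}\succeq CH^{-1/2}(I-M)H^{-1/2}C^T$, the inequality $$d(\nu_1)\ge d(\nu_2)+\langle\nabla d(\nu_2),\nu_1-\nu_2\rangle-\tfrac12\|\nu_1-\nu_2\|_{\mathbf{L}}^2$$ holds for every $\nu_1,\nu_2\in\mathbb{R}^{m+p}$. Further, for any symmetric matrix $\mathbf{L}\in\mathbb{R}^{(m+p)\times(m+p)}$ with $\mathbf{L}\not\succeq CH^{-1/2}(I-M)H^{-1/2}C^T$ there exist $\nu_1,\nu_2\in\mathbb{R}^{m+p}$ such that this inequality does not hold.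
   Context: $\mathbb{S}_+^k$ and $\mathbb{S}_{++}^k$ are the sets of symmetric positive semidefinite, respectively positive definite, real $k\times k$ matrices; $L\succeq M$ means $L-M$ is symmetric positive semidefinite, and $\not\succeq$ is its negation; $\|v\|_{\mathbf{L}}^2:=v^T\mathbf{L}v$. $I_{Ax=b}$ is the indicator function of $\{x\in\mathbb{R}^n: Ax=b\}$ (value $0$ on the set, $\infty$ elsewhere). $H^{-1/2}$ is the inverse of the symmetric positive definite square root of $H$, and $I$ in $I-M$ is the $n\times n$ identity. The conjugate of $F$ is $F^\star(y)=\sup_x\{y^Tx-F(x)\}$. The function $d$ is finite and differentiable on $\mathbb{R}^{m+p}$. *)

theory Defs
  imports "HOL-Analysis.Analysis"
begin

definition symmetric_matrix :: "real^'k^'k \<Rightarrow> bool" where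
  "symmetric_matrix S \<longleftrightarrow> transpose S = S"

definition psd :: "real^'k^'k \<Rightarrow> bool" where
  "psd S \<longleftrightarrow> symmetric_matrix S \<and> (\<forall>x. x \<bullet> (S *v x) \<ge> 0)"

definition pos_def :: "real^'k^'k \<Rightarrow> bool" where
  "pos_def S \<longleftrightarrow> symmetric_matrix S \<and> (\<forall>x. x \<noteq> 0 \<longrightarrow> x \<bullet> (S *v x) > 0)"

definition loewner_ge :: "real^'k^'k \<Rightarrow> real^'k^'k \<Rightarrow> bool" (infix "\<succeq>" 50) where
  "L \<succeq> M \<longleftrightarrow> psd (L - M)"

text \<open>Intended for positive definite \<open>H\<close>, where such an \<open>S\<close> exists and is unique.\<close>
definition matrix_sqrt :: "real^'k^'k \<Rightarrow> real^'k^'k" where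
  "matrix_sqrt H = (THE S. pos_def S \<and> S ** S = H)"

definition inv_sqrt :: "real^'k^'k \<Rightarrow> real^'k^'k" where
  "inv_sqrt H = matrix_inv (matrix_sqrt H)"

text \<open>\<open>wnorm2 L v\<close> is $\|v\|_L^2$; it is a quadratic form in \<open>v\<close> for every square \<open>L\<close>,
  and may be negative when \<open>L\<close> is not positive semidefinite.\<close>
definition wnorm2 :: "real^'k^'k \<Rightarrow> real^'k \<Rightarrow> real" where
  "wnorm2 L v = v \<bullet> (L *v v)"

text \<open>The index type \<open>'m + 'p\<close> has \<open>CARD('m) + CARD('p)\<close> elements; \<open>Inl\<close> selects the upper
  block and \<open>Inr\<close> the lower one.\<close>
definition stack_rows :: "real^'n^'m \<Rightarrow> real^'n^'p \<Rightarrow> real^'n^('m + 'p)" where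
  "stack_rows A B = (\<chi> i. case i of Inl j \<Rightarrow> A $ j | Inr k \<Rightarrow> B $ k)"

definition stack_vec :: "real^'m \<Rightarrow> real^'p \<Rightarrow> real^('m + 'p)" where
  "stack_vec u v = (\<chi> i. case i of Inl j \<Rightarrow> u $ j | Inr k \<Rightarrow> v $ k)"

definition indicator_fun :: "'a set \<Rightarrow> 'a \<Rightarrow> ereal" where
  "indicator_fun S x = (if x \<in> S then 0 else \<infinity>)"

definition conjugate :: "('a::real_inner \<Rightarrow> ereal) \<Rightarrow> 'a \<Rightarrow> ereal" where
  "conjugate F y = (SUP x. ereal (y \<bullet> x) - F x)"

text \<open>Unspecified at points where \<open>f\<close> is not differentiable.\<close>
definition gradient :: "('a::real_inner \<Rightarrow> real) \<Rightarrow> 'a \<Rightarrow> 'a" where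
  "gradient f x = (THE g. GDERIV f x :> g)"

end

theory Submission
  imports Defs
begin

text \<open>
  The dual function is an exact quadratic, so the descent inequality can be read off from its Hessian.

  Write \<open>K = H\<^sup>-\<^sup>1\<close>, \<open>W = (A K A\<^sup>T)\<^sup>-\<^sup>1\<close> and \<open>P = K - K A\<^sup>T W A K\<close>. Maximising
  \<open>y \<bullet> x - f x\<close> over \<open>A x = b\<close> is an equality constrained concave quadratic problem. Its KKT system
  is solved by \<open>x = P (y - \<zeta>) + K A\<^sup>T W b\<close>, and completing the square around this point shows that the
  conjugate is quadratic in \<open>y\<close> with Hessian \<open>P\<close> (\<open>conjugate_constrained_quadratic\<close>). Substituting
  \<open>y = - C\<^sup>T \<nu>\<close>, the dual function is quadratic with Hessian \<open>- G\<close>, where \<open>G = C P C\<^sup>T\<close>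
  (\<open>dual_function_quadratic\<close>). Since \<open>H\<^sup>-\<^sup>1\<^sup>/\<^sup>2\<close> squares to \<open>K\<close>, the matrix
  \<open>C H\<^sup>-\<^sup>1\<^sup>/\<^sup>2 (I - M) H\<^sup>-\<^sup>1\<^sup>/\<^sup>2 C\<^sup>T\<close> is this same \<open>G\<close>.

  Taylor expansion is exact for quadratics, so the two sides of the descent inequality differ by
  \<open>wnorm2 (L - G) (\<nu>\<^sub>1 - \<nu>\<^sub>2) / 2\<close> (\<open>quadratic_expansion\<close>). The inequality thus holds for all
  pairs of points if and only if the form \<open>L - G\<close> is nonnegative, which for symmetric \<open>L\<close> is
  \<open>L \<succeq> G\<close>.

  The square root of \<open>H\<close> is given as the unique positive definite solution of \<open>S\<^sup>2 = H\<close>, so its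
  existence and uniqueness are needed as well. Existence comes from a contraction
  (\<open>selfadjoint_quadratic_fixpoint\<close>), uniqueness from a trace identity (\<open>pos_def_sqrt_unique\<close>);
  neither goes through the spectral theorem.
\<close>

section \<open>Symmetric and positive definite matrices\<close>

lemma inner_matrix_transpose:
  fixes A :: "real^'n^'m"
  shows "(A *v x) \<bullet> y = x \<bullet> (transpose A *v y)"
  by (metis dot_lmul_matrix inner_commute transpose_matrix_vector)

lemma symmetric_matrix_inner:
  assumes "symmetric_matrix S"
  shows "(S *v x) \<bullet> y = x \<bullet> (S *v y)"
  using inner_matrix_transpose[of S x y] assms by (simp only: symmetric_matrix_def)

lemma symmetric_matrixI:
  fixes S :: "real^'k^'k"
  assumes "\<And>x y. (S *v x) \<bullet> y = x \<bullet> (S *v y)"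
  shows "symmetric_matrix S"
proof -
  have "transpose S *v y = S *v y" for y
    by (metis assms inner_matrix_transpose vector_eq_ldot)
  then show ?thesis
    unfolding symmetric_matrix_def by (simp only: matrix_eq simp_thms)
qed

lemma pos_def_symmetric: "pos_def S \<Longrightarrow> symmetric_matrix S"
  by (simp add: pos_def_def)

lemma pos_def_inner_nonneg: "pos_def S \<Longrightarrow> 0 \<le> x \<bullet> (S *v x)"
  by (cases "x = 0") (auto simp: pos_def_def less_imp_le)

lemma pos_def_inner_zero: "pos_def S \<Longrightarrow> x \<bullet> (S *v x) = 0 \<Longrightarrow> x = 0"
  by (auto simp: pos_def_def)

lemma pos_def_imp_invertible:
  assumes "pos_def S"
  shows "invertible S"
proof -
  have "inj ((*v) S)"
  proof (rule injI)
    fix x y assume "S *v x = S *v y"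
    then have "(x - y) \<bullet> (S *v (x - y)) = 0"
      by (simp add: algebra_simps)
    then show "x = y"
      using pos_def_inner_zero[OF assms] by fastforce
  qed
  then show ?thesis
    using matrix_left_invertible_injective invertible_left_inverse by blast
qed

lemma pos_def_matrix_inv_mult:
  assumes "pos_def S"
  shows "S ** matrix_inv S = mat 1" "matrix_inv S ** S = mat 1"
  using someI_ex[OF pos_def_imp_invertible[OF assms, unfolded invertible_def]]
  unfolding matrix_inv_def by auto

lemma pos_def_matrix_inv:
  assumes "pos_def S"
  shows "pos_def (matrix_inv S)"
proof -
  note S = pos_def_matrix_inv_mult[OF assms]
  note sym = symmetric_matrix_inner[OF pos_def_symmetric[OF assms]]
  have cancel: "S *v (matrix_inv S *v x) = x" for x
    by (simp add: matrix_vector_mul_assoc S)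
  have swap: "(matrix_inv S *v x) \<bullet> y = x \<bullet> (matrix_inv S *v y)" for x y
    by (metis cancel sym)
  moreover have "0 < x \<bullet> (matrix_inv S *v x)" if "x \<noteq> 0" for x
  proof -
    have "x \<bullet> (matrix_inv S *v x) = (matrix_inv S *v x) \<bullet> (S *v (matrix_inv S *v x))"
      by (simp only: cancel inner_commute)
    moreover have "matrix_inv S *v x \<noteq> 0"
      using cancel[of x] that by auto
    ultimately show ?thesis
      using assms by (simp add: pos_def_def)
  qed
  ultimately show ?thesis
    by (simp add: pos_def_def symmetric_matrixI)
qed

text \<open>
  Injectivity of \<open>A\<^sup>T\<close> prevents the form \<open>v \<mapsto> (A\<^sup>T v) \<bullet> K (A\<^sup>T v)\<close> from vanishing off \<open>0\<close>. With
  \<open>K = H\<^sup>-\<^sup>1\<close> this makes the Schur complement \<open>A H\<^sup>-\<^sup>1 A\<^sup>T\<close> invertible.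
\<close>

lemma pos_def_congruence:
  fixes A :: "real^'n^'m"
  assumes "pos_def K" and inj: "\<And>v. transpose A *v v = 0 \<Longrightarrow> v = 0"
  shows "pos_def (A ** K ** transpose A)"
proof -
  have app: "(A ** K ** transpose A) *v v = A *v (K *v (transpose A *v v))" for v
    by (simp only: matrix_vector_mul_assoc matrix_mul_assoc)
  note sym = symmetric_matrix_inner[OF pos_def_symmetric[OF assms(1)]]
  have "x \<bullet> (A *v (K *v (transpose A *v y))) = (transpose A *v x) \<bullet> (K *v (transpose A *v y))" for x y
    by (metis inner_commute inner_matrix_transpose)
  then have form: "x \<bullet> ((A ** K ** transpose A) *v y)
      = (transpose A *v x) \<bullet> (K *v (transpose A *v y))" for x y
    by (simp only: app)
  show ?thesis
    unfolding pos_def_def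
  proof (intro conjI allI impI)
    show "symmetric_matrix (A ** K ** transpose A)"
      by (rule symmetric_matrixI) (metis form sym inner_commute)
    show "0 < x \<bullet> ((A ** K ** transpose A) *v x)" if "x \<noteq> 0" for x
      using assms(1) inj that unfolding form pos_def_def by blast
  qed
qed

lemma pos_def_coercive:
  fixes H :: "real^'n^'n"
  assumes "pos_def H"
  obtains m where "0 < m" "\<And>x. m * (norm x)\<^sup>2 \<le> x \<bullet> (H *v x)"
proof -
  have "continuous_on (sphere 0 1) (\<lambda>x. x \<bullet> (H *v x))"
    by (intro continuous_intros matrix_vector_mult_linear_continuous_on)
  moreover have "axis undefined 1 \<in> sphere (0::real^'n) 1"
    by (simp add: norm_axis_1)
  ultimately obtain u where u: "u \<in> sphere 0 1"
      "\<And>x. x \<in> sphere 0 1 \<Longrightarrow> u \<bullet> (H *v u) \<le> x \<bullet> (H *v x)"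
    using continuous_attains_inf[of "sphere (0::real^'n) 1" "\<lambda>x. x \<bullet> (H *v x)"] compact_sphere
    by blast
  show thesis
  proof
    have "u \<noteq> 0"
      using u(1) by auto
    then show "0 < u \<bullet> (H *v u)"
      using assms by (simp add: pos_def_def)
    show "u \<bullet> (H *v u) * (norm x)\<^sup>2 \<le> x \<bullet> (H *v x)" for x
    proof (cases "x = 0")
      case False
      define y where "y = (1 / norm x) *\<^sub>R x"
      have "x = norm x *\<^sub>R y" and "y \<in> sphere 0 1"
        using False by (auto simp: y_def)
      then have "x \<bullet> (H *v x) = (norm x)\<^sup>2 * (y \<bullet> (H *v y))"
        by (metis inner_scaleR_left inner_scaleR_right matrix_vector_mult_scaleR
            mult.assoc power2_eq_square)
      then show ?thesis
        using u(2)[OF \<open>y \<in> sphere 0 1\<close>] by (metis mult.commute mult_left_mono zero_le_power2)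
    qed simp
  qed
qed

section \<open>The positive definite square root\<close>

text \<open>
  Two roots \<open>S\<close> and \<open>T\<close> with difference \<open>D\<close> satisfy \<open>S D + D T = S\<^sup>2 - T\<^sup>2 = 0\<close>. Hence
  \<open>tr (D S D) + tr (D T D) = 0\<close>, and \<open>tr (D S D)\<close> is the sum of the numbers
  \<open>(D e\<^sub>i) \<bullet> S (D e\<^sub>i) \<ge> 0\<close>, so every \<open>D e\<^sub>i\<close> is zero. The argument uses no eigenvectors.
\<close>

lemma pos_def_sqrt_unique:
  assumes S: "pos_def S" and T: "pos_def T" and eq: "S ** S = T ** T"
  shows "S = T"
proof -
  define D where "D = S - T"
  note symS = symmetric_matrix_inner[OF pos_def_symmetric[OF S]]
  note symT = symmetric_matrix_inner[OF pos_def_symmetric[OF T]]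
  have symD: "(D *v x) \<bullet> y = x \<bullet> (D *v y)" for x y
    by (simp add: D_def algebra_simps inner_diff_left inner_diff_right symS symT)
  have diag: "trace (D ** Q ** D) = (\<Sum>i\<in>UNIV. (D *v axis i 1) \<bullet> (Q *v (D *v axis i 1)))" for Q
  proof -
    have "(D ** Q ** D) $ i $ i = (D *v axis i 1) \<bullet> (Q *v (D *v axis i 1))" for i
    proof -
      have "(D ** Q ** D) $ i $ i = axis i 1 \<bullet> ((D ** Q ** D) *v axis i 1)"
        by (simp add: inner_axis' matrix_vector_mult_basis column_def)
      also have "\<dots> = axis i 1 \<bullet> (D *v (Q *v (D *v axis i 1)))"
        by (simp only: matrix_vector_mul_assoc matrix_mul_assoc)
      finally show ?thesis
        by (simp only: symD)
    qed
    then show ?thesis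
      by (simp add: trace_def)
  qed
  \<comment> \<open>Multiplying this identity by \<open>D\<close> from the left and taking traces leaves a sum of two
    nonnegative numbers, by cyclicity of the trace.\<close>
  have "S ** D + D ** T = 0"
  proof -
    have "(S ** D + D ** T) *v x = (S ** S - T ** T) *v x" for x
      by (simp add: D_def matrix_vector_mul_assoc[symmetric] algebra_simps)
    then show ?thesis
      using eq by (simp add: matrix_eq)
  qed
  then have "D ** (S ** D + D ** T) = 0"
    by simp
  then have "trace (D ** S ** D) + trace (D ** D ** T) = 0"
    by (metis matrix_add_ldistrib matrix_mul_assoc trace_add trace_0 mat_0)
  moreover have "trace (D ** D ** T) = trace (D ** T ** D)"
    by (metis matrix_mul_assoc trace_mul_sym)
  moreover have "0 \<le> trace (D ** T ** D)"
    unfolding diag by (intro sum_nonneg pos_def_inner_nonneg[OF T])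
  moreover have "0 \<le> trace (D ** S ** D)"
    unfolding diag by (intro sum_nonneg pos_def_inner_nonneg[OF S])
  ultimately have "trace (D ** S ** D) = 0"
    by linarith
  then have "(D *v axis i 1) \<bullet> (S *v (D *v axis i 1)) = 0" for i
    unfolding diag by (subst (asm) sum_nonneg_eq_0_iff) (auto intro: pos_def_inner_nonneg[OF S])
  then have "column i D = 0" for i
    using pos_def_inner_zero[OF S] by (metis matrix_vector_mult_basis)
  then have "D = 0"
    by (simp add: column_def vec_eq_iff)
  then show ?thesis
    by (simp add: D_def)
qed

text \<open>
  With \<open>X = I - Z\<close> the equation \<open>Y = (X + Y\<^sup>2) / 2\<close> is \<open>(I - Y)\<^sup>2 = Z\<close>, so a solution is a square root
  of \<open>Z\<close> in disguise. For \<open>norm X \<le> q < 1\<close> the right-hand side maps the self-adjoint operators of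
  norm at most \<open>q\<close> to themselves and is a contraction with constant \<open>q\<close> there; this set is closed,
  so the Banach fixed point theorem applies.
\<close>

lemma selfadjoint_quadratic_fixpoint:
  fixes X :: "'a::euclidean_space \<Rightarrow>\<^sub>L 'a"
  assumes q: "norm X \<le> q" "0 \<le> q" "q < 1" and X: "\<And>x y. X x \<bullet> y = x \<bullet> X y"
  obtains Y :: "'a \<Rightarrow>\<^sub>L 'a" where "norm Y \<le> q" "\<And>x y. Y x \<bullet> y = x \<bullet> Y y"
    "Y = (1/2) *\<^sub>R (X + (Y o\<^sub>L Y))"
proof -
  define s where "s = {Y :: 'a \<Rightarrow>\<^sub>L 'a. norm Y \<le> q
    \<and> (\<forall>x y. blinfun_apply Y x \<bullet> y = x \<bullet> blinfun_apply Y y)}"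
  define \<Phi> where "\<Phi> Y = (1/2) *\<^sub>R (X + (Y o\<^sub>L Y))" for Y
  have "closed s"
    unfolding s_def
    by (intro closed_Collect_conj closed_Collect_all closed_Collect_le closed_Collect_eq
        continuous_intros)
  then have "complete s"
    by (simp add: complete_eq_closed)
  moreover have "X \<in> s"
    using q X by (simp add: s_def)
  moreover have "\<Phi> ` s \<subseteq> s"
  proof (rule image_subsetI)
    fix Y assume "Y \<in> s"
    then have Y: "norm Y \<le> q" "\<And>x y. Y x \<bullet> y = x \<bullet> Y y"
      by (auto simp: s_def)
    have "norm (Y o\<^sub>L Y) \<le> q * q"
      using norm_blinfun_compose[of Y Y] mult_mono[OF Y(1) Y(1)] q by auto
    moreover have "q * q \<le> q"
      using q by (simp add: mult_left_le)
    ultimately have "norm (X + (Y o\<^sub>L Y)) \<le> 2 * q"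
      using norm_triangle_ineq[of X "Y o\<^sub>L Y"] q(1) by linarith
    then have "norm (\<Phi> Y) \<le> q"
      by (simp add: \<Phi>_def)
    moreover have "\<Phi> Y x \<bullet> y = x \<bullet> \<Phi> Y y" for x y
      using X Y(2) by (simp add: \<Phi>_def blinfun.add_left blinfun.scaleR_left
          inner_add_left inner_add_right)
    ultimately show "\<Phi> Y \<in> s"
      by (simp add: s_def)
  qed
  moreover have "dist (\<Phi> Y) (\<Phi> Z) \<le> q * dist Y Z" if "Y \<in> s" "Z \<in> s" for Y Z
  proof -
    \<comment> \<open>\<open>Y\<^sup>2 - Z\<^sup>2 = Y (Y - Z) + (Y - Z) Z\<close> holds without commutativity.\<close>
    have "\<Phi> Y - \<Phi> Z = (1/2) *\<^sub>R ((Y o\<^sub>L (Y - Z)) + ((Y - Z) o\<^sub>L Z))"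
      by (rule blinfun_eqI)
        (simp add: \<Phi>_def blinfun.diff_left blinfun.diff_right blinfun.add_left blinfun.scaleR_left algebra_simps)
    moreover have "norm (Y o\<^sub>L (Y - Z)) \<le> q * norm (Y - Z)"
      using norm_blinfun_compose[of Y "Y - Z"] that mult_right_mono[of "norm Y" q "norm (Y - Z)"]
      by (simp add: s_def)
    moreover have "norm ((Y - Z) o\<^sub>L Z) \<le> q * norm (Y - Z)"
      using norm_blinfun_compose[of "Y - Z" Z] that mult_left_mono[of "norm Z" q "norm (Y - Z)"]
      by (simp add: s_def mult.commute)
    ultimately show ?thesis
      using norm_triangle_ineq[of "Y o\<^sub>L (Y - Z)" "(Y - Z) o\<^sub>L Z"] by (simp add: dist_norm)
  qed
  ultimately have "\<exists>!Y\<in>s. \<Phi> Y = Y"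
    using q by (intro Banach_fix[of s q]) auto
  then obtain Y where "Y \<in> s" "\<Phi> Y = Y"
    by blast
  then show thesis
    by (intro that[of Y]) (auto simp: s_def \<Phi>_def)
qed

text \<open>
  After scaling, \<open>t H = I - X\<close> with \<open>norm X < 1\<close>, and the fixed point of
  \<open>Y \<mapsto> (X + Y\<^sup>2) / 2\<close> yields the root \<open>I - Y\<close> of \<open>t H\<close>.
\<close>

lemma pos_def_sqrt_exists:
  fixes H :: "real^'n^'n"
  assumes "pos_def H"
  obtains R where "pos_def R" "R ** R = H"
proof -
  obtain m where m: "0 < m" "\<And>x. m * (norm x)\<^sup>2 \<le> x \<bullet> (H *v x)"
    using pos_def_coercive[OF assms] by blast
  obtain k where k: "0 < k" "\<And>x. norm (H *v x) \<le> norm x * k"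
    using bounded_linear.pos_bounded[OF matrix_vector_mul_bounded_linear[of H]] by blast
  note symH = symmetric_matrix_inner[OF pos_def_symmetric[OF assms]]
  \<comment> \<open>This \<open>t\<close> minimises the bound \<open>1 - 2 t m + t\<^sup>2 k\<^sup>2\<close> on \<open>(norm (I - t H))\<^sup>2\<close>;
    the minimum is \<open>1 - m\<^sup>2 / k\<^sup>2 < 1\<close>.\<close>
  define t where "t = m / k\<^sup>2"
  have "0 < t"
    using m k by (simp add: t_def)
  define X where "X = Blinfun (\<lambda>x. x - t *\<^sub>R (H *v x))"
  have X: "X x = x - t *\<^sub>R (H *v x)" for x
    unfolding X_def
    by (subst bounded_linear_Blinfun_apply)
      (auto intro!: bounded_linear_sub bounded_linear_ident bounded_linear_scaleR_right
         bounded_linear_compose[OF bounded_linear_scaleR_right])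
  \<comment> \<open>\<open>max\<close> makes the radicand nonnegative without comparing \<open>m\<close> and \<open>k\<close>.\<close>
  define q where "q = sqrt (max 0 (1 - m\<^sup>2 / k\<^sup>2))"
  have q: "0 \<le> q" "q < 1"
    using m k by (auto simp: q_def)
  have "norm X \<le> q"
  proof (rule norm_blinfun_bound[OF q(1)])
    fix x
    have "(norm (X x))\<^sup>2 = (norm x)\<^sup>2 - 2 * t * (x \<bullet> (H *v x)) + t\<^sup>2 * (norm (H *v x))\<^sup>2"
      unfolding X power2_norm_eq_inner
      by (simp add: inner_diff_left inner_diff_right inner_commute power2_eq_square algebra_simps)
    also have "\<dots> \<le> (norm x)\<^sup>2 - 2 * t * (m * (norm x)\<^sup>2) + t\<^sup>2 * (norm x * k)\<^sup>2"
      using m(2)[of x] k(2)[of x] \<open>0 < t\<close> by (intro add_mono diff_mono mult_left_mono power_mono) auto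
    also have "\<dots> = (1 - m\<^sup>2 / k\<^sup>2) * (norm x)\<^sup>2"
      using k(1) by (simp add: t_def power2_eq_square field_simps)
    also have "\<dots> \<le> q\<^sup>2 * (norm x)\<^sup>2"
      by (intro mult_right_mono) (auto simp: q_def)
    finally show "norm (X x) \<le> q * norm x"
      using q by (metis power_mult_distrib abs_le_square_iff abs_norm_cancel abs_mult abs_of_nonneg)
  qed
  moreover have "X x \<bullet> y = x \<bullet> X y" for x y
    by (simp add: X inner_diff_left inner_diff_right symH)
  ultimately obtain Y :: "(real^'n) \<Rightarrow>\<^sub>L (real^'n)" where Y: "norm Y \<le> q" "\<And>x y. Y x \<bullet> y = x \<bullet> Y y"
      "Y = (1/2) *\<^sub>R (X + (Y o\<^sub>L Y))"
    using selfadjoint_quadratic_fixpoint q by blast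
  define r where "r = 1 / sqrt t"
  have r: "0 < r" "r * (r * t) = 1"
    using \<open>0 < t\<close> by (auto simp: r_def)
  \<comment> \<open>The fixed point equation says \<open>(I - Y)\<^sup>2 = I - X = t H\<close>, so \<open>(I - Y) / sqrt t\<close> is a square
    root of \<open>H\<close>; it is positive definite because \<open>norm Y < 1\<close>.\<close>
  define R where "R = matrix (\<lambda>x. r *\<^sub>R (x - Y x))"
  have "linear (\<lambda>x. r *\<^sub>R (x - Y x))"
    by (auto intro!: linearI simp: blinfun.add_right blinfun.scaleR_right algebra_simps)
  then have R: "R *v x = r *\<^sub>R (x - Y x)" for x
    by (simp add: R_def matrix_works)
  show thesis
  proof
    have "x \<bullet> (R *v x) > 0" if "x \<noteq> 0" for x
    proof -
      have "x \<bullet> Y x \<le> norm x * (q * norm x)"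
        using norm_cauchy_schwarz[of x "Y x"] norm_blinfun[of Y x] Y(1)
        by (meson mult_left_mono mult_right_mono norm_ge_zero order_trans)
      also have "\<dots> < norm x * norm x"
        using q that by simp
      finally show ?thesis
        using r by (simp add: R inner_diff_right power2_norm_eq_inner[symmetric] power2_eq_square)
    qed
    then show "pos_def R"
      unfolding pos_def_def
      by (auto intro!: symmetric_matrixI simp: R inner_diff_left inner_diff_right Y(2))
    have "(R ** R) *v x = H *v x" for x
    proof -
      have "2 *\<^sub>R Y x = X x + Y (Y x)"
        by (subst Y(3)) (simp add: blinfun.add_left blinfun.scaleR_left)
      then have "x - 2 *\<^sub>R Y x + Y (Y x) = t *\<^sub>R (H *v x)"
        by (simp add: X)
      moreover have "(R ** R) *v x = (r * r) *\<^sub>R (x - 2 *\<^sub>R Y x + Y (Y x))"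
        by (simp add: matrix_vector_mul_assoc[symmetric] R blinfun.diff_right blinfun.scaleR_right
            scaleR_2 scaleR_right_diff_distrib scaleR_right_distrib)
      ultimately have "(R ** R) *v x = (r * (r * t)) *\<^sub>R (H *v x)"
        by simp
      then show ?thesis
        by (simp add: r)
    qed
    then show "R ** R = H"
      by (simp add: matrix_eq)
  qed
qed

lemma matrix_sqrt:
  assumes "pos_def H"
  shows "pos_def (matrix_sqrt H)" "matrix_sqrt H ** matrix_sqrt H = H"
proof -
  have "\<exists>!S. pos_def S \<and> S ** S = H"
    using pos_def_sqrt_exists[OF assms] pos_def_sqrt_unique by metis
  from theI'[OF this] show "pos_def (matrix_sqrt H)" "matrix_sqrt H ** matrix_sqrt H = H"
    unfolding matrix_sqrt_def by auto
qed

lemma inv_sqrt_square: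
  assumes "pos_def H"
  shows "inv_sqrt H ** inv_sqrt H = matrix_inv H"
proof -
  let ?R = "matrix_sqrt H" and ?S = "inv_sqrt H"
  have "?S ** ?R = mat 1"
    unfolding inv_sqrt_def by (rule pos_def_matrix_inv_mult[OF matrix_sqrt(1)[OF assms]])
  then have "(?S ** ?S) ** (?R ** ?R) = mat 1"
    by (metis matrix_mul_assoc matrix_mul_lid)
  then have "(?S ** ?S) ** H = mat 1"
    using matrix_sqrt(2)[OF assms] by simp
  then show ?thesis
    by (metis assms pos_def_matrix_inv_mult(1) matrix_mul_assoc matrix_mul_lid matrix_mul_rid)
qed

section \<open>The inverse Hessian constrained to a kernel\<close>

text \<open>
  This is the inverse of \<open>H\<close> seen from the kernel of \<open>A\<close>: the upper left block of the inverse of the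
  KKT matrix with rows \<open>(H, A\<^sup>T)\<close> and \<open>(A, 0)\<close>. It maps \<open>u\<close> to the maximiser of
  \<open>u \<bullet> x - x \<bullet> H x / 2\<close> subject to \<open>A x = 0\<close>.
\<close>

definition constrained_inverse :: "real^'n^'n \<Rightarrow> real^'n^'m \<Rightarrow> real^'n^'n" where
  "constrained_inverse H A = (let K = matrix_inv H in
     K - K ** transpose A ** matrix_inv (A ** K ** transpose A) ** A ** K)"

lemma constrained_inverse_apply:
  fixes A :: "real^'n^'m" and H :: "real^'n^'n"
  defines "K \<equiv> matrix_inv H"
  shows "constrained_inverse H A *v u
    = K *v u - K *v (transpose A *v (matrix_inv (A ** K ** transpose A) *v (A *v (K *v u))))"
  unfolding constrained_inverse_def Let_def K_def
  by (simp only: matrix_vector_mult_diff_rdistrib matrix_vector_mul_assoc matrix_mul_assoc)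

lemma constrained_inverse_symmetric:
  fixes A :: "real^'n^'m"
  assumes "pos_def H" and "\<And>v. transpose A *v v = 0 \<Longrightarrow> v = 0"
  shows "symmetric_matrix (constrained_inverse H A)"
proof -
  note K = pos_def_matrix_inv[OF assms(1)]
  note symK = symmetric_matrix_inner[OF pos_def_symmetric[OF K]]
  note symW = symmetric_matrix_inner[OF pos_def_symmetric[OF
      pos_def_matrix_inv[OF pos_def_congruence[OF K assms(2)]]]]
  have form: "x \<bullet> (constrained_inverse H A *v y) = x \<bullet> (matrix_inv H *v y)
      - (A *v (matrix_inv H *v x)) \<bullet> (matrix_inv (A ** matrix_inv H ** transpose A)
          *v (A *v (matrix_inv H *v y)))" for x y
    by (simp only: constrained_inverse_apply inner_diff_right symK[symmetric] inner_matrix_transpose)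
  show ?thesis
    by (rule symmetric_matrixI) (metis form symK symW inner_commute)
qed

text \<open>
  The first two claims are the optimality conditions for maximising \<open>u \<bullet> x - x \<bullet> H x / 2\<close> over the
  kernel of \<open>A\<close>: feasibility of \<open>P u\<close>, and a residual gradient orthogonal to the kernel. The third
  provides the minimiser of \<open>x \<bullet> H x / 2\<close> over \<open>A x = b\<close>, which shifts the kernel to that affine set.
\<close>

lemma constrained_inverse_kkt:
  fixes A :: "real^'n^'m"
  assumes "pos_def H" and "\<And>v. transpose A *v v = 0 \<Longrightarrow> v = 0"
  shows "A *v (constrained_inverse H A *v u) = 0"
    and "\<exists>\<mu>. u - H *v (constrained_inverse H A *v u) = transpose A *v \<mu>"
    and "\<exists>x \<mu>. A *v x = b \<and> H *v x = transpose A *v \<mu>"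
proof -
  define K where "K = matrix_inv H"
  define W where "W = matrix_inv (A ** K ** transpose A)"
  have HK: "H *v (K *v x) = x" for x
    by (simp add: K_def matrix_vector_mul_assoc pos_def_matrix_inv_mult[OF assms(1)])
  have "pos_def (A ** K ** transpose A)"
    unfolding K_def by (rule pos_def_congruence[OF pos_def_matrix_inv[OF assms(1)] assms(2)])
  then have "A ** K ** transpose A ** W = mat 1"
    unfolding W_def by (rule pos_def_matrix_inv_mult)
  then have W: "A *v (K *v (transpose A *v (W *v z))) = z" for z
    by (simp only: matrix_vector_mul_assoc matrix_mul_assoc matrix_vector_mul_lid)
  note P = constrained_inverse_apply[of H A, folded K_def, folded W_def]
  show "A *v (constrained_inverse H A *v u) = 0"
    by (simp add: P matrix_vector_mult_diff_distrib W del: transpose_matrix_vector)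
  \<comment> \<open>The multiplier: applying \<open>H\<close> to \<open>P u\<close> cancels the leading \<open>K\<close> in both terms of \<open>P\<close>.\<close>
  have "u - H *v (constrained_inverse H A *v u) = transpose A *v (W *v (A *v (K *v u)))"
    by (simp add: P matrix_vector_mult_diff_distrib HK del: transpose_matrix_vector)
  then show "\<exists>\<mu>. u - H *v (constrained_inverse H A *v u) = transpose A *v \<mu>"
    by blast
  \<comment> \<open>The witnesses are \<open>x = K A\<^sup>T W b\<close> and \<open>\<mu> = W b\<close>.\<close>
  show "\<exists>x \<mu>. A *v x = b \<and> H *v x = transpose A *v \<mu>"
    using W HK by blast
qed

text \<open>
  All square roots occur in adjacent pairs once the product is expanded, so only \<open>H\<^sup>-\<^sup>1\<close> remains.
\<close>

lemma inv_sqrt_projection_eq_constrained_inverse: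
  fixes A :: "real^'n^'m"
  assumes "pos_def H"
    and M: "M = inv_sqrt H ** transpose A ** matrix_inv (A ** matrix_inv H ** transpose A)
              ** A ** inv_sqrt H"
  shows "C ** inv_sqrt H ** (mat 1 - M) ** inv_sqrt H ** transpose C
       = C ** constrained_inverse H A ** transpose C"
proof -
  have S: "inv_sqrt H *v (inv_sqrt H *v x) = matrix_inv H *v x" for x
    by (simp add: matrix_vector_mul_assoc inv_sqrt_square[OF assms(1)])
  show ?thesis
    unfolding M constrained_inverse_def Let_def matrix_eq
    by (simp add: matrix_vector_mul_assoc[symmetric] matrix_vector_mult_diff_rdistrib
        matrix_vector_mult_diff_distrib S del: transpose_matrix_vector)
qed

section \<open>The conjugate and the dual function\<close>

text \<open>
  The supremum is attained at \<open>P u + x0\<close> with \<open>u = y - \<zeta>\<close>, because the assumptions are exactly the KKT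
  conditions there: \<open>P u\<close> solves the homogeneous problem for \<open>u\<close>, and \<open>x0\<close> is a feasible point of
  least \<open>H\<close>-norm. Orthogonality of the kernel of \<open>A\<close> and the range of \<open>A\<^sup>T\<close> removes all mixed terms.
\<close>

lemma conjugate_constrained_quadratic:
  fixes H P :: "real^'n^'n" and A :: "real^'n^'m"
  assumes H: "psd H" and P: "symmetric_matrix P"
    and feasible: "\<And>u. A *v (P *v u) = 0"
    and stationary: "\<And>u. \<exists>\<mu>. u - H *v (P *v u) = transpose A *v \<mu>"
    and x0: "A *v x0 = b" "H *v x0 = transpose A *v \<mu>0"
  shows "conjugate (\<lambda>x. ereal (1/2 * (x \<bullet> (H *v x)) + \<zeta> \<bullet> x) + indicator_fun {x. A *v x = b} x) y
       = ereal (1/2 * ((y - \<zeta>) \<bullet> (P *v (y - \<zeta>))) + (y - \<zeta>) \<bullet> x0 - 1/2 * (x0 \<bullet> (H *v x0)))"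
    (is "conjugate ?F y = ereal ?v")
proof -
  define u where "u = y - \<zeta>"
  define p where "p = P *v u"
  obtain \<mu> where \<mu>: "u - H *v p = transpose A *v \<mu>"
    using stationary unfolding p_def by blast
  have symH: "(H *v x) \<bullet> z = x \<bullet> (H *v z)" for x z
    using H by (simp add: psd_def symmetric_matrix_inner)
  have swap: "x \<bullet> (H *v z) = z \<bullet> (H *v x)" for x z
    by (subst inner_commute) (rule symH)
  have orth: "z \<bullet> (transpose A *v w) = 0" if "A *v z = 0" for z w
    using that by (simp add: inner_matrix_transpose[symmetric] del: transpose_matrix_vector)
  have Ap: "A *v p = 0"
    by (simp add: p_def feasible)
  have pu: "p \<bullet> (H *v p) = u \<bullet> p"
    using orth[OF Ap, of \<mu>] unfolding \<mu>[symmetric] by (simp add: inner_diff_right inner_commute)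
  have px0: "p \<bullet> (H *v x0) = 0"
    using orth[OF Ap, of \<mu>0] x0(2) by simp
  have F: "ereal (y \<bullet> x) - ?F x
      = (if A *v x = b then ereal (u \<bullet> x - 1/2 * (x \<bullet> (H *v x))) else - \<infinity>)" for x
    by (simp add: indicator_fun_def u_def inner_diff_left)
  \<comment> \<open>Completing the square around \<open>p + x0\<close>: the linear term in \<open>e\<close> is \<open>e \<bullet> (u - H (p + x0))\<close>,
    which vanishes because \<open>e\<close> lies in the kernel of \<open>A\<close> and the other factor in the range of
    \<open>A\<^sup>T\<close>.\<close>
  have value_at: "u \<bullet> x - 1/2 * (x \<bullet> (H *v x)) = ?v - 1/2 * (e \<bullet> (H *v e))"
    if "A *v x = b" and e: "e = x - (p + x0)" for x e
  proof -
    have x: "x = e + p + x0"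
      by (simp add: e)
    have Ae: "A *v e = 0"
      using that(1) Ap x0(1)
      by (simp add: e matrix_vector_mult_diff_distrib matrix_vector_right_distrib)
    have eu: "e \<bullet> (H *v p) = e \<bullet> u"
      using orth[OF Ae, of \<mu>] unfolding \<mu>[symmetric] by (simp add: inner_diff_right)
    have ex0: "e \<bullet> (H *v x0) = 0"
      using orth[OF Ae, of \<mu>0] x0(2) by simp
    have "x \<bullet> (H *v x) = e \<bullet> (H *v e) + p \<bullet> (H *v p) + x0 \<bullet> (H *v x0)
        + 2 * (e \<bullet> (H *v p)) + 2 * (e \<bullet> (H *v x0)) + 2 * (p \<bullet> (H *v x0))"
      using swap[of p e] swap[of x0 e] swap[of x0 p] unfolding x
      by (simp add: matrix_vector_right_distrib inner_add_left inner_add_right)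
    then show ?thesis
      unfolding eu ex0 px0 pu u_def[symmetric] p_def[symmetric]
      by (simp add: x inner_add_right inner_commute[of e u] add_divide_distrib)
  qed
  show ?thesis
    unfolding conjugate_def
  proof (rule antisym)
    show "(SUP x. ereal (y \<bullet> x) - ?F x) \<le> ereal ?v"
    proof (rule SUP_least)
      fix x
      show "ereal (y \<bullet> x) - ?F x \<le> ereal ?v"
        using value_at[of x] H unfolding F psd_def by simp
    qed
    have "ereal ?v = ereal (y \<bullet> (p + x0)) - ?F (p + x0)"
      using value_at[of "p + x0"] Ap x0(1) unfolding F by (simp add: matrix_vector_right_distrib)
    also have "\<dots> \<le> (SUP x. ereal (y \<bullet> x) - ?F x)"
      by (rule SUP_upper) simp
    finally show "ereal ?v \<le> (SUP x. ereal (y \<bullet> x) - ?F x)" .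
  qed
qed

text \<open>
  The conjugate is finite everywhere and quadratic with Hessian \<open>P\<close>, so composing it with \<open>- C\<^sup>T\<close> gives a
  concave quadratic with Hessian \<open>- C P C\<^sup>T\<close>.
\<close>

lemma dual_function_quadratic:
  fixes A :: "real^'n^'m" and C :: "real^'n^'k"
  assumes H: "pos_def H" and A: "\<And>v. transpose A *v v = 0 \<Longrightarrow> v = 0"
    and F: "F = (\<lambda>x. ereal (1/2 * (x \<bullet> (H *v x)) + \<zeta> \<bullet> x) + indicator_fun {x. A *v x = b} x)"
  shows "\<exists>g \<kappa>. (\<lambda>\<nu>. real_of_ereal (- conjugate F (- (transpose C *v \<nu>)) - ereal (c \<bullet> \<nu>)))
    = (\<lambda>\<nu>. - 1/2 * (\<nu> \<bullet> ((C ** constrained_inverse H A ** transpose C) *v \<nu>)) + g \<bullet> \<nu> + \<kappa>)"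
proof -
  define P where "P = constrained_inverse H A"
  obtain x0 \<mu>0 where x0: "A *v x0 = b" "H *v x0 = transpose A *v \<mu>0"
    using constrained_inverse_kkt(3)[OF H A] by blast
  have symP: "symmetric_matrix P"
    unfolding P_def by (rule constrained_inverse_symmetric[OF H A])
  have psd: "psd H"
    using H pos_def_inner_nonneg by (auto simp: psd_def pos_def_def)
  \<comment> \<open>\<open>g\<close> and \<open>\<kappa>\<close> are the linear and constant parts of the negated conjugate at \<open>- C\<^sup>T \<nu>\<close>,
    with \<open>c \<bullet> \<nu>\<close> subtracted.\<close>
  define g where "g = C *v x0 - C *v (P *v \<zeta>) - c"
  define \<kappa> where "\<kappa> = \<zeta> \<bullet> x0 + 1/2 * (x0 \<bullet> (H *v x0)) - 1/2 * (\<zeta> \<bullet> (P *v \<zeta>))"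
  have "real_of_ereal (- conjugate F (- (transpose C *v \<nu>)) - ereal (c \<bullet> \<nu>))
      = - 1/2 * (\<nu> \<bullet> ((C ** P ** transpose C) *v \<nu>)) + g \<bullet> \<nu> + \<kappa>" for \<nu>
  proof -
    define w where "w = transpose C *v \<nu>"
    have Cw: "(C *v x) \<bullet> \<nu> = x \<bullet> w" for x
      unfolding w_def by (rule inner_matrix_transpose)
    have "conjugate F (- w) = ereal (1/2 * ((- w - \<zeta>) \<bullet> (P *v (- w - \<zeta>)))
        + (- w - \<zeta>) \<bullet> x0 - 1/2 * (x0 \<bullet> (H *v x0)))"
      unfolding F
      by (rule conjugate_constrained_quadratic[OF psd symP _ _ x0])
        (simp_all only: P_def constrained_inverse_kkt[OF H A])
    moreover have "(- w - \<zeta>) \<bullet> (P *v (- w - \<zeta>)) = w \<bullet> (P *v w) + 2 * (w \<bullet> (P *v \<zeta>)) + \<zeta> \<bullet> (P *v \<zeta>)"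
    proof -
      have "P *v (- w - \<zeta>) = - (P *v w) - P *v \<zeta>"
        using matrix_vector_mult_diff_distrib[of P 0 w]
        by (simp add: matrix_vector_mult_diff_distrib)
      moreover have "\<zeta> \<bullet> (P *v w) = w \<bullet> (P *v \<zeta>)"
        by (metis symmetric_matrix_inner[OF symP] inner_commute)
      ultimately show ?thesis
        by (simp add: inner_diff_left inner_diff_right)
    qed
    moreover have "\<nu> \<bullet> ((C ** P ** transpose C) *v \<nu>) = w \<bullet> (P *v w)"
    proof -
      have "\<nu> \<bullet> ((C ** P ** transpose C) *v \<nu>) = (C *v (P *v w)) \<bullet> \<nu>"
        unfolding w_def by (simp only: matrix_vector_mul_assoc matrix_mul_assoc inner_commute)
      then show ?thesis
        by (simp only: Cw inner_commute[of "P *v w" w])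
    qed
    moreover have "g \<bullet> \<nu> = w \<bullet> x0 - w \<bullet> (P *v \<zeta>) - c \<bullet> \<nu>"
      by (simp add: g_def inner_diff_left Cw inner_commute[of w])
    ultimately show ?thesis
      unfolding w_def[symmetric]
      by (simp add: \<kappa>_def inner_diff_left algebra_simps add_divide_distrib diff_divide_distrib)
  qed
  then show ?thesis
    unfolding P_def by blast
qed

section \<open>Gradients and exact expansions of quadratics\<close>

lemma gradient_eqI:
  assumes "GDERIV f x :> g"
  shows "gradient f x = g"
  unfolding gradient_def
proof (rule the_equality)
  show "GDERIV f x :> g"
    by (rule assms)
next
  fix g' assume "GDERIV f x :> g'"
  then have "(\<lambda>h. h \<bullet> g') = (\<lambda>h. h \<bullet> g)"
    using assms unfolding gderiv_def by (rule has_derivative_unique)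
  then have "\<forall>h. h \<bullet> g' = h \<bullet> g"
    by (simp add: fun_eq_iff)
  then show "g' = g"
    by (rule vector_eq_ldot[THEN iffD1])
qed

lemma gradient_quadratic:
  fixes G :: "real^'k^'k"
  assumes "symmetric_matrix G"
  shows "gradient (\<lambda>\<nu>. - 1/2 * (\<nu> \<bullet> (G *v \<nu>)) + g \<bullet> \<nu> + \<kappa>) \<nu> = g - G *v \<nu>"
proof (rule gradient_eqI, unfold gderiv_def)
  have G: "((*v) G has_derivative (*v) G) (at \<nu>)"
    by (rule bounded_linear_imp_has_derivative) simp
  have swap: "\<nu> \<bullet> (G *v h) = h \<bullet> (G *v \<nu>)" for h
    by (subst inner_commute) (rule symmetric_matrix_inner[OF assms])
  have "((\<lambda>\<nu>. - 1/2 * (\<nu> \<bullet> (G *v \<nu>)) + g \<bullet> \<nu> + \<kappa>) has_derivative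
      (\<lambda>h. - 1/2 * (\<nu> \<bullet> (G *v h) + h \<bullet> (G *v \<nu>)) + g \<bullet> h + 0)) (at \<nu>)"
    by (intro has_derivative_add has_derivative_mult_right has_derivative_inner
        has_derivative_inner_right has_derivative_const has_derivative_ident G)
  moreover have "(\<lambda>h. - 1/2 * (\<nu> \<bullet> (G *v h) + h \<bullet> (G *v \<nu>)) + g \<bullet> h + 0) = (\<lambda>h. h \<bullet> (g - G *v \<nu>))"
    by (rule ext) (simp add: swap inner_diff_right inner_commute[of g])
  ultimately show "((\<lambda>\<nu>. - 1/2 * (\<nu> \<bullet> (G *v \<nu>)) + g \<bullet> \<nu> + \<kappa>) has_derivative
      (\<lambda>h. h \<bullet> (g - G *v \<nu>))) (at \<nu>)"
    by simp
qed

text \<open>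
  The second-order Taylor expansion of a quadratic is exact, so the gap in the descent inequality is
  itself a quadratic form in \<open>\<nu>\<^sub>1 - \<nu>\<^sub>2\<close>.
\<close>

lemma quadratic_expansion:
  fixes G :: "real^'k^'k"
  assumes G: "symmetric_matrix G" and d: "d = (\<lambda>\<nu>. - 1/2 * (\<nu> \<bullet> (G *v \<nu>)) + g \<bullet> \<nu> + \<kappa>)"
  shows "d \<nu>\<^sub>1 - (d \<nu>\<^sub>2 + gradient d \<nu>\<^sub>2 \<bullet> (\<nu>\<^sub>1 - \<nu>\<^sub>2) - 1/2 * wnorm2 L (\<nu>\<^sub>1 - \<nu>\<^sub>2))
       = 1/2 * wnorm2 (L - G) (\<nu>\<^sub>1 - \<nu>\<^sub>2)"
proof -
  define e where "e = \<nu>\<^sub>1 - \<nu>\<^sub>2"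
  have \<nu>1: "\<nu>\<^sub>1 = \<nu>\<^sub>2 + e"
    by (simp add: e_def)
  have "e \<bullet> (G *v \<nu>\<^sub>2) = \<nu>\<^sub>2 \<bullet> (G *v e)"
    by (metis G inner_commute symmetric_matrix_inner)
  moreover have grad: "gradient d \<nu>\<^sub>2 = g - G *v \<nu>\<^sub>2"
    unfolding d by (rule gradient_quadratic[OF G])
  ultimately show ?thesis
    unfolding e_def[symmetric] grad unfolding \<nu>1 wnorm2_def d
    by (simp add: algebra_simps inner_add_left inner_add_right inner_diff_left inner_diff_right
        inner_commute[of _ e] add_divide_distrib diff_divide_distrib)
qed

section \<open>Tight smoothness of the dual function\<close>

theorem proposition14:
  fixes A :: "real^'n^'m" and B :: "real^'n^'p" and C :: "real^'n^('m + 'p)"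
    and H M :: "real^'n^'n" and b :: "real^'m" and c :: "real^('m + 'p)" and \<zeta> :: "real^'n"
    and f :: "real^'n \<Rightarrow> real" and h F :: "real^'n \<Rightarrow> ereal"
    and d :: "real^('m + 'p) \<Rightarrow> real"
  assumes "rank A = CARD('m)"
    and "pos_def H"
    and "f = (\<lambda>x. 1/2 * (x \<bullet> (H *v x)) + \<zeta> \<bullet> x)"
    and "h = indicator_fun {x. A *v x = b}"
    and "C = stack_rows A B"
    and "c = stack_vec b 0"
    and "F = (\<lambda>x. ereal (f x) + h x)"
    and "d = (\<lambda>\<nu>. real_of_ereal (- conjugate F (- (transpose C *v \<nu>)) - ereal (c \<bullet> \<nu>)))"
    and "M = inv_sqrt H ** transpose A ** matrix_inv (A ** matrix_inv H ** transpose A)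
              ** A ** inv_sqrt H"
  shows "(\<forall>L. psd L \<and> L \<succeq> C ** inv_sqrt H ** (mat 1 - M) ** inv_sqrt H ** transpose C \<longrightarrow>
            (\<forall>\<nu>\<^sub>1 \<nu>\<^sub>2. d \<nu>\<^sub>1 \<ge> d \<nu>\<^sub>2 + gradient d \<nu>\<^sub>2 \<bullet> (\<nu>\<^sub>1 - \<nu>\<^sub>2)
                          - 1/2 * wnorm2 L (\<nu>\<^sub>1 - \<nu>\<^sub>2))) \<and>
         (\<forall>L. symmetric_matrix L
              \<and> \<not> L \<succeq> C ** inv_sqrt H ** (mat 1 - M) ** inv_sqrt H ** transpose C \<longrightarrow>
            (\<exists>\<nu>\<^sub>1 \<nu>\<^sub>2. \<not> d \<nu>\<^sub>1 \<ge> d \<nu>\<^sub>2 + gradient d \<nu>\<^sub>2 \<bullet> (\<nu>\<^sub>1 - \<nu>\<^sub>2)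
                          - 1/2 * wnorm2 L (\<nu>\<^sub>1 - \<nu>\<^sub>2)))"
proof -
  define G where "G = C ** constrained_inverse H A ** transpose C"
  have A: "v = 0" if "transpose A *v v = 0" for v
  proof -
    have "inj ((*v) (transpose A))"
      using assms(1) full_rank_injective[of "transpose A"] by (simp add: rank_transpose)
    then show ?thesis
      by (rule injD) (simp only: that matrix_vector_mult_0_right)
  qed
  have bound: "C ** inv_sqrt H ** (mat 1 - M) ** inv_sqrt H ** transpose C = G"
    unfolding G_def
    by (rule inv_sqrt_projection_eq_constrained_inverse[OF \<open>pos_def H\<close> assms(9)])
  have symG: "symmetric_matrix G"
    using constrained_inverse_symmetric[OF \<open>pos_def H\<close> A]
    unfolding G_def symmetric_matrix_def by (simp add: matrix_transpose_mul matrix_mul_assoc)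
  obtain g \<kappa> where "d = (\<lambda>\<nu>. - 1/2 * (\<nu> \<bullet> (G *v \<nu>)) + g \<bullet> \<nu> + \<kappa>)"
    using dual_function_quadratic[OF \<open>pos_def H\<close> A, where F = F and C = C and c = c] assms(3,4,7,8)
    unfolding G_def by blast
  note expansion = quadratic_expansion[OF symG this]
  have descent: "d \<nu>\<^sub>1 \<ge> d \<nu>\<^sub>2 + gradient d \<nu>\<^sub>2 \<bullet> (\<nu>\<^sub>1 - \<nu>\<^sub>2) - 1/2 * wnorm2 L (\<nu>\<^sub>1 - \<nu>\<^sub>2)
      \<longleftrightarrow> 0 \<le> wnorm2 (L - G) (\<nu>\<^sub>1 - \<nu>\<^sub>2)" for L \<nu>\<^sub>1 \<nu>\<^sub>2
    using expansion[of \<nu>\<^sub>1 \<nu>\<^sub>2 L] by linarith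
  show ?thesis
    unfolding bound descent
  proof (intro conjI allI impI)
    fix L \<nu>\<^sub>1 \<nu>\<^sub>2
    assume "psd L \<and> L \<succeq> G"
    then show "0 \<le> wnorm2 (L - G) (\<nu>\<^sub>1 - \<nu>\<^sub>2)"
      by (simp add: loewner_ge_def psd_def wnorm2_def)
  next
    fix L
    assume L: "symmetric_matrix L \<and> \<not> L \<succeq> G"
    have "symmetric_matrix (L - G)"
      using L symG
      by (auto intro!: symmetric_matrixI
          simp: matrix_vector_mult_diff_rdistrib inner_diff_left inner_diff_right symmetric_matrix_inner)
    then obtain x where "x \<bullet> ((L - G) *v x) < 0"
      using L by (auto simp: loewner_ge_def psd_def not_le)
    \<comment> \<open>A direction of negative curvature of \<open>L - G\<close> violates the inequality when moving from \<open>0\<close>.\<close>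
    then have "\<not> 0 \<le> wnorm2 (L - G) (x - 0)"
      by (simp add: wnorm2_def)
    then show "\<exists>\<nu>\<^sub>1 \<nu>\<^sub>2. \<not> 0 \<le> wnorm2 (L - G) (\<nu>\<^sub>1 - \<nu>\<^sub>2)"
      by blast
  qed
qed

end
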